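(* Let $(R,\mathfrak m)$ be a discrete valuation ring, and let $S$ be a faithfully flat $R$-algebra. Then $S$ is a content $R$-algebra (equivalently, a Gaussian $R$-algebra) if and only if $\mathfrak m S$ is a prime ideal of $S$ and $\bigcap_{n} \mathfrak m^n S=0$.
   Context: All rings are commutative with identity. For a ring $R$, an $R$-module $M$ and $f\in M$, the (Ohm-Rush) content of $f$ is the ideal $c(f):=\bigcap\{I\subseteq R \text{ ideal} \mid f\in IM\}$. An $R$-algebra $S$ is Ohm-Rush if $f\in c(f)S$ for all $f\in S$. An Ohm-Rush $R$-algebra $S$ is a content algebra if it is faithfully flat over $R$ and for any $f,g\in S$ there is some positive integer $n$ with $c(f)^n c(g)=c(f)^{n-1}c(fg)$. It is a Gaussian algebra if it is faithfully flat over $R$ and $c(fg)=c(f)c(g)$ for all $f,g\in S$. *)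

theory Defs
  imports "HOL-Algebra.Algebra"
begin

definition discrete_valuation_ring :: "('a, 'c) ring_scheme \<Rightarrow> 'a set \<Rightarrow> bool"
  where "discrete_valuation_ring R \<mm> \<longleftrightarrow>
    principal_domain R \<and> maximalideal \<mm> R \<and> (\<forall>\<nn>. maximalideal \<nn> R \<longrightarrow> \<nn> = \<mm>) \<and>
    \<mm> \<noteq> {\<zero>\<^bsub>R\<^esub>}"

text \<open>The group of finite sums of elements \<open>a x\<close> with \<open>a \<in> I\<close> and \<open>x \<in> M\<close>.  For an algebra
  \<open>S\<close> this is the extended ideal \<open>I S\<close>.\<close>

definition ideal_smult :: "'a set \<Rightarrow> ('a, 'b, 'd) module_scheme \<Rightarrow> 'b set"
  where "ideal_smult I M =
    generate (add_monoid M) {a \<odot>\<^bsub>M\<^esub> x | a x. a \<in> I \<and> x \<in> carrier M}"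

text \<open>The library's \<open>ideals_set R\<close> has ideal multiplication and the unit \<open>carrier R\<close>, so
  the zeroth power of an ideal is \<open>R\<close>.\<close>

abbreviation ideal_pow :: "('a, 'c) ring_scheme \<Rightarrow> 'a set \<Rightarrow> nat \<Rightarrow> 'a set"
  where "ideal_pow R I n \<equiv> I [^]\<^bsub>ideals_set R\<^esub> n"


section \<open>Tensor products and faithful flatness\<close>

text \<open>The tensor product of \<open>M\<close> and \<open>N\<close>, as an abelian group: the free abelian group on
  \<open>M \<times> N\<close> modulo the usual relations.  Its \<open>R\<close>-module structure plays no role for
  exactness.\<close>

definition tensor_relations ::
    "('a, 'c) ring_scheme \<Rightarrow> ('a, 'b, 'd) module_scheme \<Rightarrow> ('a, 'e, 'f) module_scheme
      \<Rightarrow> ('b \<times> 'e \<Rightarrow>\<^sub>0 int) set"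
  where "tensor_relations R M N =
    generate (free_Abelian_group (carrier M \<times> carrier N))
      ({frag_of (x \<oplus>\<^bsub>M\<^esub> x', y) - frag_of (x, y) - frag_of (x', y) | x x' y.
          x \<in> carrier M \<and> x' \<in> carrier M \<and> y \<in> carrier N} \<union>
       {frag_of (x, y \<oplus>\<^bsub>N\<^esub> y') - frag_of (x, y) - frag_of (x, y') | x y y'.
          x \<in> carrier M \<and> y \<in> carrier N \<and> y' \<in> carrier N} \<union>
       {frag_of (a \<odot>\<^bsub>M\<^esub> x, y) - frag_of (x, a \<odot>\<^bsub>N\<^esub> y) | a x y.
          a \<in> carrier R \<and> x \<in> carrier M \<and> y \<in> carrier N})"

definition tensor_product ::
    "('a, 'c) ring_scheme \<Rightarrow> ('a, 'b, 'd) module_scheme \<Rightarrow> ('a, 'e, 'f) module_scheme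
      \<Rightarrow> ('b \<times> 'e \<Rightarrow>\<^sub>0 int) set monoid"
  where "tensor_product R M N =
    free_Abelian_group (carrier M \<times> carrier N) Mod tensor_relations R M N"

definition linear_maps ::
    "('a, 'c) ring_scheme \<Rightarrow> ('a, 'b, 'd) module_scheme \<Rightarrow> ('a, 'e, 'f) module_scheme
      \<Rightarrow> ('b \<Rightarrow> 'e) set"
  where "linear_maps R M N =
    {f \<in> hom (add_monoid M) (add_monoid N).
      \<forall>a\<in>carrier R. \<forall>x\<in>carrier M. f (a \<odot>\<^bsub>M\<^esub> x) = a \<odot>\<^bsub>N\<^esub> f x}"

text \<open>The map from the tensor product of \<open>S\<close> with the source of the linear map \<open>f\<close> to the
  tensor product of \<open>S\<close> with its target \<open>N\<close>, induced by \<open>s \<otimes> x \<mapsto> s \<otimes> f x\<close>.  The image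
  under \<open>the_elem\<close> is a singleton, as \<open>f\<close> respects the relations.\<close>

definition tensor_map ::
    "('a, 'c) ring_scheme \<Rightarrow> ('a, 'b, 'd) module_scheme \<Rightarrow> ('a, 'e, 'f) module_scheme
      \<Rightarrow> ('g \<Rightarrow> 'e) \<Rightarrow> ('b \<times> 'g \<Rightarrow>\<^sub>0 int) set \<Rightarrow> ('b \<times> 'e \<Rightarrow>\<^sub>0 int) set"
  where "tensor_map R S N f C =
    the_elem ((\<lambda>c. tensor_relations R S N
        #>\<^bsub>free_Abelian_group (carrier S \<times> carrier N)\<^esub>
        frag_extend (\<lambda>(s, x). frag_of (s, f x)) c) ` C)"

text \<open>A sequence of \<open>R\<close>-modules is exact if and only if its tensor product with \<open>S\<close> is.  HOL
  cannot quantify over modules on all types.  Every countably generated \<open>R\<close>-module is a quotient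
  of a direct sum of countably many copies of \<open>R\<close>, hence isomorphic to a module whose elements
  are cosets of type \<open>(nat \<Rightarrow> 'a) set\<close>; this is the type used here.  Nothing is
  lost: the inclusions of finitely generated ideals into \<open>R\<close> detect flatness, the residue fields
  \<open>R/\<mm>\<close> detect faithfulness of a flat module, and a faithfully flat module satisfies the
  equivalence for all modules.\<close>

definition faithfully_flat ::
    "('a, 'c) ring_scheme \<Rightarrow> ('a, 'b, 'd) module_scheme \<Rightarrow> bool"
  where "faithfully_flat R S \<longleftrightarrow> module R S \<and>
    (\<forall>(L :: ('a, (nat \<Rightarrow> 'a) set) module) (M :: ('a, (nat \<Rightarrow> 'a) set) module)
      (N :: ('a, (nat \<Rightarrow> 'a) set) module).
      \<forall>f\<in>linear_maps R L M. \<forall>g\<in>linear_maps R M N.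
        module R L \<longrightarrow> module R M \<longrightarrow> module R N \<longrightarrow>
        (f ` carrier L = a_kernel M N g \<longleftrightarrow>
         tensor_map R S M f ` carrier (tensor_product R S L) =
           kernel (tensor_product R S M) (tensor_product R S N) (tensor_map R S N g)))"


section \<open>Ohm-Rush content and classes of algebras\<close>

definition content ::
    "('a, 'c) ring_scheme \<Rightarrow> ('a, 'b, 'd) module_scheme \<Rightarrow> 'b \<Rightarrow> 'a set"
  where "content R M f = \<Inter> {I. ideal I R \<and> f \<in> ideal_smult I M}"

definition ohm_rush_algebra ::
    "('a, 'c) ring_scheme \<Rightarrow> ('a, 'b, 'd) module_scheme \<Rightarrow> bool"
  where "ohm_rush_algebra R S \<longleftrightarrow>
    algebra R S \<and> (\<forall>f\<in>carrier S. f \<in> ideal_smult (content R S f) S)"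

definition content_algebra ::
    "('a, 'c) ring_scheme \<Rightarrow> ('a, 'b, 'd) module_scheme \<Rightarrow> bool"
  where "content_algebra R S \<longleftrightarrow>
    ohm_rush_algebra R S \<and> faithfully_flat R S \<and>
    (\<forall>f\<in>carrier S. \<forall>g\<in>carrier S. \<exists>n>0.
      ideal_pow R (content R S f) n \<cdot>\<^bsub>R\<^esub> content R S g =
      ideal_pow R (content R S f) (n - 1) \<cdot>\<^bsub>R\<^esub> content R S (f \<otimes>\<^bsub>S\<^esub> g))"

definition gaussian_algebra ::
    "('a, 'c) ring_scheme \<Rightarrow> ('a, 'b, 'd) module_scheme \<Rightarrow> bool"
  where "gaussian_algebra R S \<longleftrightarrow>
    ohm_rush_algebra R S \<and> faithfully_flat R S \<and>
    (\<forall>f\<in>carrier S. \<forall>g\<in>carrier S.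
      content R S (f \<otimes>\<^bsub>S\<^esub> g) = content R S f \<cdot>\<^bsub>R\<^esub> content R S g)"

end

theory Submission
  imports Defs
begin

text \<open>Let \<open>t\<close> generate \<open>\<mm>\<close>.  Tensoring the sequence \<open>R \<rightarrow> R \<rightarrow> R\<close> of multiplications by \<open>a\<close>
  and \<open>b\<close> with \<open>S\<close> gives the sequence \<open>S \<rightarrow> S \<rightarrow> S\<close> of multiplications by \<open>a\<close> and \<open>b\<close>.  Faithful
  flatness for \<open>(a, b) = (0, t)\<close> and \<open>(a, b) = (t, 0)\<close> therefore says that \<open>t\<close> is a nonzerodivisor
  on \<open>S\<close> and that \<open>t S \<noteq> S\<close>.  Every nonzero ideal of \<open>R\<close> is generated by a power of \<open>t\<close>, so
  \<open>c(t\<^sup>n h) = \<mm>\<^sup>n\<close> for \<open>h \<notin> t S\<close>.  If \<open>t S\<close> is prime and \<open>\<Inter>\<^sub>n t\<^sup>n S = 0\<close>, every nonzero element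
  has this form and contents multiply.  Conversely, in a content algebra elements outside \<open>t S\<close>
  have unit content, hence so do their products, and an element of \<open>\<Inter>\<^sub>n t\<^sup>n S\<close> has content
  \<open>\<Inter>\<^sub>n \<mm>\<^sup>n = 0\<close>.\<close>

section \<open>Tensoring with the regular module\<close>

text \<open>A copy of \<open>R\<close> as a module over itself, transported along an injection \<open>e\<close> to the fixed type
  over which the definition of faithful flatness quantifies.\<close>

definition regular_module :: "('a, 'c) ring_scheme \<Rightarrow> ('a \<Rightarrow> 'p) \<Rightarrow> ('a, 'p) module"
  where "regular_module R e =
    \<lparr>carrier = e ` carrier R,
     monoid.mult = \<lambda>p q. e (the_inv e p \<otimes>\<^bsub>R\<^esub> the_inv e q),
     one = e \<one>\<^bsub>R\<^esub>,
     ring.zero = e \<zero>\<^bsub>R\<^esub>,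
     add = \<lambda>p q. e (the_inv e p \<oplus>\<^bsub>R\<^esub> the_inv e q),
     smult = \<lambda>a p. e (a \<otimes>\<^bsub>R\<^esub> the_inv e p)\<rparr>"

locale tensor_regular = module R S for R :: "('a, 'b) ring_scheme" (structure)
    and S :: "('a, 'c, 'd) module_scheme" +
  fixes e :: "'a \<Rightarrow> 'p"
  assumes inj_e: "inj e"
begin

abbreviation P :: "('a, 'p) module"
  where "P \<equiv> regular_module R e"

abbreviation F :: "('c \<times> 'p \<Rightarrow>\<^sub>0 int) monoid"
  where "F \<equiv> free_Abelian_group (carrier S \<times> carrier P)"

abbreviation T :: "('c \<times> 'p \<Rightarrow>\<^sub>0 int) set"
  where "T \<equiv> tensor_relations R S P"

lemma regular_simps [simp]:
  "carrier P = e ` carrier R"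
  "\<zero>\<^bsub>P\<^esub> = e \<zero>"
  "e a \<oplus>\<^bsub>P\<^esub> e b = e (a \<oplus> b)"
  "a \<odot>\<^bsub>P\<^esub> e b = e (a \<otimes> b)"
  by (simp_all add: regular_module_def the_inv_f_f[OF inj_e])

lemma e_eq_iff [simp]: "e a = e b \<longleftrightarrow> a = b"
  using inj_e by (auto dest: injD)

lemma module_regular: "module R P"
proof (rule moduleI)
  show "abelian_group P"
  proof (rule abelian_groupI)
    fix x assume "x \<in> carrier P"
    then show "\<exists>y\<in>carrier P. y \<oplus>\<^bsub>P\<^esub> x = \<zero>\<^bsub>P\<^esub>"
      by (auto intro!: bexI[where x = "\<ominus> a" for a] R.l_neg)
  qed (auto simp: R.a_ac)
qed (auto simp: R.l_distr R.r_distr R.m_assoc R.is_cring)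

lemma linear_maps_regular: "a \<in> carrier R \<Longrightarrow> (\<odot>\<^bsub>P\<^esub>) a \<in> linear_maps R P P"
  by (auto simp: linear_maps_def hom_def R.r_distr R.m_lcomm)

text \<open>The image and the kernel in \<open>P\<close> are the copies under \<open>e\<close> of
  those in \<open>R\<close>, and an injection reflects equality of images.\<close>

lemma regular_exact_iff:
  assumes "a \<in> carrier R" "b \<in> carrier R"
  shows "(\<odot>\<^bsub>P\<^esub>) a ` carrier P = a_kernel P P ((\<odot>\<^bsub>P\<^esub>) b) \<longleftrightarrow>
    (\<otimes>) a ` carrier R = {x \<in> carrier R. b \<otimes> x = \<zero>}"
proof -
  have "(\<odot>\<^bsub>P\<^esub>) a ` carrier P = e ` (\<otimes>) a ` carrier R"
    by (auto simp: image_image)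
  moreover have "a_kernel P P ((\<odot>\<^bsub>P\<^esub>) b) = e ` {x \<in> carrier R. b \<otimes> x = \<zero>}"
    by (auto simp: a_kernel_def')
  ultimately show ?thesis
    by (simp add: inj_image_eq_iff[OF inj_e])
qed

section \<open>The subgroup of tensor relations\<close>

lemma group_F: "group F"
  by simp

lemma subgroup_T: "subgroup T F"
  unfolding tensor_relations_def
  by (rule group.generate_is_subgroup[OF group_F])
    (auto dest!: keys_diff[THEN subsetD] simp: keys_frag_of)

lemma T_add: "x \<in> T \<Longrightarrow> y \<in> T \<Longrightarrow> x + y \<in> T"
  using subgroup.m_closed[OF subgroup_T] by simp

lemma T_carrier: "x \<in> T \<Longrightarrow> Poly_Mapping.keys x \<subseteq> carrier S \<times> carrier P"
  using subgroup.mem_carrier[OF subgroup_T] by simp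

lemma T_minus: "x \<in> T \<Longrightarrow> - x \<in> T"
  using subgroup.m_inv_closed[OF subgroup_T, of x] T_carrier[of x] by simp

lemma T_diff: "x \<in> T \<Longrightarrow> y \<in> T \<Longrightarrow> x - y \<in> T"
  using T_add[OF _ T_minus, of x y] by simp

lemma T_relation_add:
  "x \<in> carrier S \<Longrightarrow> y \<in> carrier S \<Longrightarrow> a \<in> carrier R \<Longrightarrow>
    frag_of (x \<oplus>\<^bsub>S\<^esub> y, e a) - frag_of (x, e a) - frag_of (y, e a) \<in> T"
  unfolding tensor_relations_def by (rule generate.incl) auto

lemma T_relation_smult:
  assumes "a \<in> carrier R" "x \<in> carrier S" "b \<in> carrier R"
  shows "frag_of (a \<odot>\<^bsub>S\<^esub> x, e b) - frag_of (x, e (a \<otimes> b)) \<in> T"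
  unfolding tensor_relations_def
proof (rule generate.incl, rule UnI2, unfold mem_Collect_eq, intro exI conjI)
  show "frag_of (a \<odot>\<^bsub>S\<^esub> x, e b) - frag_of (x, e (a \<otimes> b)) =
    frag_of (a \<odot>\<^bsub>S\<^esub> x, e b) - frag_of (x, a \<odot>\<^bsub>P\<^esub> e b)"
    by simp
qed (use assms in auto)

text \<open>The lift of the balanced map sending \<open>(s, e a)\<close> to \<open>a s\<close>. The
  universal property of the free abelian group only asserts existence, hence the choice
  operator.\<close>

definition evaluation :: "('c \<times> 'p \<Rightarrow>\<^sub>0 int) \<Rightarrow> 'c"
  where "evaluation = (SOME h. h \<in> hom F (add_monoid S) \<and>
    (\<forall>s\<in>carrier S. \<forall>a\<in>carrier R. h (frag_of (s, e a)) = a \<odot>\<^bsub>S\<^esub> s))"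

lemma evaluation_hom: "evaluation \<in> hom F (add_monoid S)"
  and evaluation_frag_of:
    "s \<in> carrier S \<Longrightarrow> a \<in> carrier R \<Longrightarrow> evaluation (frag_of (s, e a)) = a \<odot>\<^bsub>S\<^esub> s"
proof -
  let ?f = "\<lambda>(s, p). the_inv e p \<odot>\<^bsub>S\<^esub> s"
  have "?f ` (carrier S \<times> carrier P) \<subseteq> carrier (add_monoid S)"
    by (auto simp: the_inv_f_f[OF inj_e])
  then obtain h where "h \<in> hom F (add_monoid S)"
    and "\<And>x. x \<in> carrier S \<times> carrier P \<Longrightarrow> h (frag_of x) = ?f x"
    using comm_group.free_Abelian_group_universal[OF M.a_comm_group] by blast
  then have "\<exists>h. h \<in> hom F (add_monoid S) \<and>
      (\<forall>s\<in>carrier S. \<forall>a\<in>carrier R. h (frag_of (s, e a)) = a \<odot>\<^bsub>S\<^esub> s)"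
    by (intro exI[of _ h]) (auto simp: the_inv_f_f[OF inj_e])
  from someI_ex[OF this, folded evaluation_def]
  show "evaluation \<in> hom F (add_monoid S)"
    "s \<in> carrier S \<Longrightarrow> a \<in> carrier R \<Longrightarrow> evaluation (frag_of (s, e a)) = a \<odot>\<^bsub>S\<^esub> s"
    by auto
qed

sublocale ev: group_hom F "add_monoid S" evaluation
  using evaluation_hom by (auto simp: group_hom_def group_hom_axioms_def M.a_group)

lemma evaluation_closed:
  "Poly_Mapping.keys c \<subseteq> carrier S \<times> carrier P \<Longrightarrow> evaluation c \<in> carrier S"
  using ev.hom_closed[of c] by simp

lemma evaluation_diff:
  assumes "Poly_Mapping.keys c \<subseteq> carrier S \<times> carrier P"
    and "Poly_Mapping.keys d \<subseteq> carrier S \<times> carrier P"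
  shows "evaluation (c - d) = evaluation c \<ominus>\<^bsub>S\<^esub> evaluation d"
  using ev.hom_mult[of c "- d"] ev.hom_inv[of d] assms by (simp add: a_minus_def a_inv_def)

lemma evaluation_zero: "evaluation 0 = \<zero>\<^bsub>S\<^esub>"
  using ev.hom_one by simp

text \<open>Both additivity relations of the tensor product have the shape \<open>x - y - z\<close>,
  so one computation serves for the two.\<close>

lemma generator_mem_kernel:
  assumes "x \<in> carrier S \<times> carrier P" "y \<in> carrier S \<times> carrier P" "z \<in> carrier S \<times> carrier P"
    and "evaluation (frag_of x) = evaluation (frag_of y) \<oplus>\<^bsub>S\<^esub> evaluation (frag_of z)"
  shows "frag_of x - frag_of y - frag_of z \<in> kernel F (add_monoid S) evaluation"
proof -
  have k: "Poly_Mapping.keys (frag_of x - frag_of y) \<subseteq> carrier S \<times> carrier P"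
    "Poly_Mapping.keys (frag_of x - frag_of y - frag_of z) \<subseteq> carrier S \<times> carrier P"
    using assms(1-3) by (auto dest!: keys_diff[THEN subsetD] simp: keys_frag_of)
  have [simp]: "evaluation (frag_of y) \<in> carrier S" "evaluation (frag_of z) \<in> carrier S"
    using assms by (auto intro!: evaluation_closed simp: keys_frag_of)
  have "evaluation (frag_of x - frag_of y - frag_of z) =
      evaluation (frag_of x) \<ominus>\<^bsub>S\<^esub> evaluation (frag_of y) \<ominus>\<^bsub>S\<^esub> evaluation (frag_of z)"
    using assms(1-3) k by (simp add: evaluation_diff keys_frag_of)
  also have "\<dots> = (evaluation (frag_of y) \<oplus>\<^bsub>S\<^esub> evaluation (frag_of z)) \<ominus>\<^bsub>S\<^esub>
      (evaluation (frag_of y) \<oplus>\<^bsub>S\<^esub> evaluation (frag_of z))"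
    by (simp add: assms(4) M.minus_eq M.a_assoc M.minus_add)
  also have "\<dots> = \<zero>\<^bsub>S\<^esub>"
    by (simp add: M.minus_eq M.r_neg)
  finally show ?thesis
    using k by (simp add: kernel_def)
qed

text \<open>The kernel of \<open>evaluation\<close> is a subgroup, so only the three families of
  generators of \<open>T\<close> need checking.\<close>

lemma T_le_kernel: "c \<in> T \<Longrightarrow> evaluation c = \<zero>\<^bsub>S\<^esub>"
proof -
  have "T \<subseteq> kernel F (add_monoid S) evaluation"
    unfolding tensor_relations_def
  proof (rule group.generate_subgroup_incl[OF group_F _ ev.subgroup_kernel], safe)
    fix x y p assume "x \<in> carrier S" "y \<in> carrier S" "p \<in> carrier P"
    then show "frag_of (x \<oplus>\<^bsub>S\<^esub> y, p) - frag_of (x, p) - frag_of (y, p)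
        \<in> kernel F (add_monoid S) evaluation"
      by (intro generator_mem_kernel) (auto simp: evaluation_frag_of smult_r_distr)
  next
    fix x p q assume "x \<in> carrier S" "p \<in> carrier P" "q \<in> carrier P"
    then show "frag_of (x, p \<oplus>\<^bsub>P\<^esub> q) - frag_of (x, p) - frag_of (x, q)
        \<in> kernel F (add_monoid S) evaluation"
      by (intro generator_mem_kernel) (auto simp: evaluation_frag_of smult_l_distr)
  next
    fix a x p assume "a \<in> carrier R" "x \<in> carrier S" "p \<in> carrier P"
    then obtain b where "p = e b" "b \<in> carrier R" "a \<in> carrier R" "x \<in> carrier S"
      by auto
    \<comment> \<open>The relation moving a scalar across the tensor sign is respected because
      \<open>R\<close> is commutative.\<close>
    moreover from this have "a \<odot>\<^bsub>S\<^esub> (b \<odot>\<^bsub>S\<^esub> x) = b \<odot>\<^bsub>S\<^esub> (a \<odot>\<^bsub>S\<^esub> x)"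
      by (metis smult_assoc1 R.m_comm)
    ultimately show "frag_of (a \<odot>\<^bsub>S\<^esub> x, p) - frag_of (x, a \<odot>\<^bsub>P\<^esub> p)
        \<in> kernel F (add_monoid S) evaluation"
      using keys_diff[of "frag_of (a \<odot>\<^bsub>S\<^esub> x, e b)" "frag_of (x, e (a \<otimes> b))"]
      by (auto simp: kernel_def evaluation_diff evaluation_frag_of keys_frag_of smult_assoc1
          M.minus_eq M.r_neg)
  qed
  then show "c \<in> T \<Longrightarrow> evaluation c = \<zero>\<^bsub>S\<^esub>"
    by (auto simp: kernel_def)
qed

text \<open>Modulo \<open>T\<close>, a generator \<open>(s, e a)\<close> equals
  \<open>(a s, e \<one>)\<close>, and such terms combine by additivity in the first slot. So every
  class is a single tensor with \<open>\<one>\<close>, which makes evaluation injective on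
  classes.\<close>

lemma diff_frag_of_evaluation_mem_T:
  "Poly_Mapping.keys c \<subseteq> carrier S \<times> carrier P \<Longrightarrow> c - frag_of (evaluation c, e \<one>) \<in> T"
proof (induction c rule: free_Abelian_group_induct[consumes 1, case_names 1 2 3])
  case 1
  \<comment> \<open>For \<open>0 + 0 = 0\<close> the additivity relation collapses to the negative
    of the tensor of \<open>0\<close> with \<open>\<one>\<close>.\<close>
  then show ?case
    using T_relation_add[of "\<zero>\<^bsub>S\<^esub>" "\<zero>\<^bsub>S\<^esub>" \<one>] by (simp add: evaluation_zero)
next
  case (2 x y)
  let ?u = "evaluation x" and ?v = "evaluation y"
  have [simp]: "?u \<in> carrier S" "?v \<in> carrier S"
    using 2 by (simp_all add: evaluation_closed)
  have "(?u \<ominus>\<^bsub>S\<^esub> ?v) \<oplus>\<^bsub>S\<^esub> ?v = ?u"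
    by (simp add: a_minus_def M.a_assoc M.l_neg)
  then have "frag_of (?u, e \<one>) - frag_of (?u \<ominus>\<^bsub>S\<^esub> ?v, e \<one>) - frag_of (?v, e \<one>) \<in> T"
    using T_relation_add[of "?u \<ominus>\<^bsub>S\<^esub> ?v" ?v \<one>] by simp
  from T_add[OF T_diff[OF 2(3,4)] this] show ?case
    using 2 by (simp add: evaluation_diff)
next
  case (3 x)
  then obtain s a where x: "x = (s, e a)" "s \<in> carrier S" "a \<in> carrier R"
    by auto
  show ?case
    using T_minus[OF T_relation_smult[of a s \<one>]] x by (simp add: evaluation_frag_of)
qed

lemma T_iff:
  assumes "Poly_Mapping.keys c \<subseteq> carrier S \<times> carrier P"
  shows "c \<in> T \<longleftrightarrow> evaluation c = \<zero>\<^bsub>S\<^esub>"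
proof
  assume "evaluation c = \<zero>\<^bsub>S\<^esub>"
  then have "c - frag_of (\<zero>\<^bsub>S\<^esub>, e \<one>) \<in> T" "0 - frag_of (\<zero>\<^bsub>S\<^esub>, e \<one>) \<in> T"
    using diff_frag_of_evaluation_mem_T[OF assms] diff_frag_of_evaluation_mem_T[of 0]
    by (simp_all add: evaluation_zero)
  from T_diff[OF this] show "c \<in> T"
    by simp
qed (rule T_le_kernel)

text \<open>The elements of the tensor product \<open>S \<otimes> P\<close>, which are cosets, are exactly the fibres of
  \<open>evaluation\<close>; this identifies \<open>S \<otimes> P\<close> with \<open>S\<close>.\<close>

definition fibre :: "'c \<Rightarrow> ('c \<times> 'p \<Rightarrow>\<^sub>0 int) set"
  where "fibre s = {c \<in> carrier F. evaluation c = s}"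

text \<open>Two elements share a coset exactly when their difference lies in \<open>T\<close>, which
  by \<open>T_iff\<close> means that \<open>evaluation\<close> kills it.\<close>

lemma T_coset:
  assumes c: "c \<in> carrier F"
  shows "T #>\<^bsub>F\<^esub> c = fibre (evaluation c)"
proof (rule Set.set_eqI)
  fix x
  have "x \<in> T #>\<^bsub>F\<^esub> c \<longleftrightarrow> x - c \<in> T"
    by (auto simp: r_coset_def intro: bexI[of _ "x - c"])
  also have "\<dots> \<longleftrightarrow> x \<in> fibre (evaluation c)"
  proof
    assume T: "x - c \<in> T"
    have x: "x \<in> carrier F"
      using T_carrier[OF T] c keys_add[of "x - c" c] by auto
    then have "evaluation x \<ominus>\<^bsub>S\<^esub> evaluation c = \<zero>\<^bsub>S\<^esub>"
      using c T_le_kernel[OF T] by (simp add: evaluation_diff)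
    then have "evaluation x = evaluation c"
      using x c evaluation_closed[of x] evaluation_closed[of c]
        M.minus_equality[of "evaluation x" "\<ominus>\<^bsub>S\<^esub> evaluation c"]
      by (simp add: M.minus_eq)
    then show "x \<in> fibre (evaluation c)"
      using x by (simp add: fibre_def)
  next
    assume "x \<in> fibre (evaluation c)"
    then have x: "x \<in> carrier F" "evaluation x = evaluation c"
      by (simp_all add: fibre_def)
    have "Poly_Mapping.keys (x - c) \<subseteq> carrier S \<times> carrier P"
      using x(1) c keys_diff[of x c] by auto
    moreover have "evaluation (x - c) = \<zero>\<^bsub>S\<^esub>"
      using x c by (simp add: evaluation_diff evaluation_closed M.minus_eq M.r_neg)
    ultimately show "x - c \<in> T"
      by (simp add: T_iff)
  qed
  finally show "x \<in> T #>\<^bsub>F\<^esub> c \<longleftrightarrow> x \<in> fibre (evaluation c)" .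
qed

lemma frag_of_mem_fibre: "s \<in> carrier S \<Longrightarrow> frag_of (s, e \<one>) \<in> fibre s"
  by (auto simp: fibre_def evaluation_frag_of keys_frag_of)

lemma evaluation_fibre: "c \<in> fibre s \<Longrightarrow> evaluation c = s"
  by (simp add: fibre_def)

text \<open>Each fibre over \<open>carrier S\<close> contains a tensor with \<open>\<one>\<close>,
  and evaluating this element recovers the base point.\<close>

lemma inj_on_fibre: "inj_on fibre (carrier S)"
proof (rule inj_onI)
  fix s u assume s: "s \<in> carrier S" and eq: "fibre s = fibre u"
  from evaluation_fibre[OF frag_of_mem_fibre[OF s]]
    evaluation_fibre[OF frag_of_mem_fibre[OF s, unfolded eq]]
  show "s = u"
    by (rule subst)
qed

lemma evaluation_surj: "evaluation ` carrier F = carrier S"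
proof
  show "carrier S \<subseteq> evaluation ` carrier F"
  proof
    fix s assume "s \<in> carrier S"
    from frag_of_mem_fibre[OF this]
    have "frag_of (s, e \<one>) \<in> carrier F" "s = evaluation (frag_of (s, e \<one>))"
      by (simp_all only: fibre_def mem_Collect_eq)
    then show "s \<in> evaluation ` carrier F"
      by (rule rev_image_eqI)
  qed
next
  show "evaluation ` carrier F \<subseteq> carrier S"
    using ev.hom_closed by auto
qed

section \<open>The tensor product and its induced maps, read off on \<open>S\<close>\<close>

lemma carrier_tensor: "carrier (tensor_product R S P) = fibre ` carrier S"
proof -
  have "(\<lambda>c. T #>\<^bsub>F\<^esub> c) ` carrier F = (\<lambda>c. fibre (evaluation c)) ` carrier F"
    by (rule image_cong[OF refl T_coset])
  also have "\<dots> = fibre ` (evaluation ` carrier F)"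
    by (rule image_image[symmetric])
  finally show ?thesis
    unfolding tensor_product_def carrier_FactGroup evaluation_surj .
qed

lemma one_tensor: "one (tensor_product R S P) = fibre \<zero>\<^bsub>S\<^esub>"
  using T_coset[of 0] group.coset_mult_one[OF group_F, of T] subgroup.subset[OF subgroup_T]
  by (simp add: tensor_product_def evaluation_zero)

text \<open>Naturality of \<open>evaluation\<close> under scaling the second slot: on a generator
  \<open>(s, e b)\<close> both values are \<open>(a b) s\<close>. The bound on the keys is part of
  the induction because \<open>evaluation_diff\<close> requires it.\<close>

lemma evaluation_map:
  assumes "a \<in> carrier R" "Poly_Mapping.keys c \<subseteq> carrier S \<times> carrier P"
  defines "d \<equiv> frag_extend (\<lambda>(s, p). frag_of (s, a \<odot>\<^bsub>P\<^esub> p)) c"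
  shows "Poly_Mapping.keys d \<subseteq> carrier S \<times> carrier P \<and> evaluation d = a \<odot>\<^bsub>S\<^esub> evaluation c"
  using assms(2) unfolding d_def
proof (induction c rule: free_Abelian_group_induct[consumes 1, case_names 1 2 3])
  case 1
  then show ?case using assms(1) by (simp add: evaluation_zero)
next
  case (2 x y)
  let ?g = "frag_extend (\<lambda>(s, p). frag_of (s, a \<odot>\<^bsub>P\<^esub> p))"
  have keys: "Poly_Mapping.keys (?g x - ?g y) \<subseteq> carrier S \<times> carrier P"
    using 2(3,4) keys_diff[of "?g x" "?g y"] by blast
  have "evaluation (?g x - ?g y) = a \<odot>\<^bsub>S\<^esub> (evaluation x \<ominus>\<^bsub>S\<^esub> evaluation y)"
    using 2 assms(1) evaluation_closed[of x] evaluation_closed[of y]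
    by (simp add: evaluation_diff smult_r_distr smult_r_minus M.minus_eq)
  with keys 2(1,2) show ?case
    by (simp add: frag_extend_diff evaluation_diff)
next
  case (3 x)
  then obtain s b where "x = (s, e b)" "s \<in> carrier S" "b \<in> carrier R"
    by auto
  then show ?case
    using assms(1) by (simp add: evaluation_frag_of smult_assoc1 keys_frag_of)
qed

text \<open>By \<open>evaluation_map\<close> all representatives in \<open>fibre s\<close> are sent
  to the same coset. As the fibre is nonempty, \<open>the_elem\<close> is applied to a genuine
  singleton.\<close>

lemma tensor_map_fibre:
  assumes "a \<in> carrier R" "s \<in> carrier S"
  shows "tensor_map R S P ((\<odot>\<^bsub>P\<^esub>) a) (fibre s) = fibre (a \<odot>\<^bsub>S\<^esub> s)"
proof -
  have "(\<lambda>c. T #>\<^bsub>F\<^esub> frag_extend (\<lambda>(s, p). frag_of (s, a \<odot>\<^bsub>P\<^esub> p)) c) ` fibre s =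
      (\<lambda>c. fibre (a \<odot>\<^bsub>S\<^esub> s)) ` fibre s"
    using evaluation_map[OF assms(1)]
    by (intro image_cong refl) (simp add: T_coset fibre_def del: regular_simps)
  also have "\<dots> = {fibre (a \<odot>\<^bsub>S\<^esub> s)}"
    using frag_of_mem_fibre[OF assms(2)] by auto
  finally show ?thesis
    by (simp add: tensor_map_def)
qed

lemma tensor_exact_iff:
  assumes "a \<in> carrier R" "b \<in> carrier R"
  shows "tensor_map R S P ((\<odot>\<^bsub>P\<^esub>) a) ` carrier (tensor_product R S P) =
      kernel (tensor_product R S P) (tensor_product R S P) (tensor_map R S P ((\<odot>\<^bsub>P\<^esub>) b)) \<longleftrightarrow>
    (\<odot>\<^bsub>S\<^esub>) a ` carrier S = {s \<in> carrier S. b \<odot>\<^bsub>S\<^esub> s = \<zero>\<^bsub>S\<^esub>}"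
proof -
  have "tensor_map R S P ((\<odot>\<^bsub>P\<^esub>) a) ` carrier (tensor_product R S P) =
      fibre ` (\<odot>\<^bsub>S\<^esub>) a ` carrier S"
    using assms by (simp add: carrier_tensor image_image tensor_map_fibre cong: image_cong_simp)
  moreover have "kernel (tensor_product R S P) (tensor_product R S P) (tensor_map R S P ((\<odot>\<^bsub>P\<^esub>) b))
      = fibre ` {s \<in> carrier S. b \<odot>\<^bsub>S\<^esub> s = \<zero>\<^bsub>S\<^esub>}"
    using assms by (auto simp: kernel_def carrier_tensor one_tensor tensor_map_fibre
        inj_on_eq_iff[OF inj_on_fibre])
  moreover have "fibre ` (\<odot>\<^bsub>S\<^esub>) a ` carrier S = fibre ` {s \<in> carrier S. b \<odot>\<^bsub>S\<^esub> s = \<zero>\<^bsub>S\<^esub>} \<longleftrightarrow>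
      (\<odot>\<^bsub>S\<^esub>) a ` carrier S = {s \<in> carrier S. b \<odot>\<^bsub>S\<^esub> s = \<zero>\<^bsub>S\<^esub>}"
    using assms by (intro inj_on_image_eq_iff[OF inj_on_fibre]) auto
  ultimately show ?thesis
    by simp
qed

end

text \<open>The definition of faithful flatness is applied to three copies of the regular module,
  and both exactness statements are then translated back to \<open>R\<close> and
  \<open>S\<close>.\<close>

lemma faithfully_flat_exact_iff:
  fixes R (structure)
  assumes "faithfully_flat R S" "a \<in> carrier R" "b \<in> carrier R"
  shows "(\<otimes>) a ` carrier R = {x \<in> carrier R. b \<otimes> x = \<zero>} \<longleftrightarrow>
    (\<odot>\<^bsub>S\<^esub>) a ` carrier S = {s \<in> carrier S. b \<odot>\<^bsub>S\<^esub> s = \<zero>\<^bsub>S\<^esub>}"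
proof -
  \<comment> \<open>An element of \<open>R\<close> is coded as the singleton of a constant sequence,
    which places the regular module on the type fixed in \<open>faithfully_flat\<close>.\<close>
  interpret tensor_regular R S "\<lambda>x. {\<lambda>_::nat. x}"
    using assms(1) by (auto simp: tensor_regular_def tensor_regular_axioms_def faithfully_flat_def
        inj_on_def fun_eq_iff)
  show ?thesis
    using assms linear_maps_regular module_regular
    unfolding faithfully_flat_def regular_exact_iff[OF assms(2,3), symmetric]
      tensor_exact_iff[OF assms(2,3), symmetric]
    by blast
qed

section \<open>Principal ideals, extended ideals and contents\<close>

lemma (in cring) cgenideal_image: "PIdl a = (\<lambda>x. x \<otimes> a) ` carrier R"
  by (auto simp: cgenideal_def)

lemma (in cring) cgenideal_zero: "PIdl \<zero> = {\<zero>}"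
  by (simp add: cgenideal_eq_genideal genideal_zero)

lemma (in cring) cgenideal_one: "PIdl \<one> = carrier R"
  by (simp add: cgenideal_eq_genideal genideal_one)

lemma (in cring) ideal_prod_cgenideal:
  assumes "a \<in> carrier R" "b \<in> carrier R"
  shows "(PIdl a) \<cdot> (PIdl b) = PIdl (a \<otimes> b)"
proof -
  have "(PIdl a) \<cdot> (PIdl b) = Idl (PIdl (a \<otimes> b))"
    using assms by (simp add: ideal_prod_eq_genideal cgenideal_ideal cgenideal_prod)
  also have "\<dots> = PIdl (a \<otimes> b)"
    using assms cgenideal_ideal[of "a \<otimes> b"]
    by (intro subset_antisym genideal_minimal genideal_self) (auto dest: ideal.Icarr)
  finally show ?thesis .
qed

lemma (in cring) ideal_pow_cgenideal:
  assumes "a \<in> carrier R"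
  shows "ideal_pow R (PIdl a) n = PIdl (a [^] n)"
proof (induction n)
  case 0
  show ?case
    by (simp add: nat_pow_def[of "ideals_set R"] ideals_set_def cgenideal_one)
next
  case (Suc n)
  then show ?case
    using assms by (simp add: nat_pow_def[of "ideals_set R"] ideals_set_def ideal_prod_cgenideal)
qed

text \<open>Since \<open>(r a) x = a (r x)\<close>, all generators are multiples of
  \<open>a\<close>, and these already form a subgroup: taking finite sums adds nothing.\<close>

lemma (in module) cgenideal_smult:
  assumes "a \<in> carrier R"
  shows "ideal_smult (PIdl a) M = (\<odot>\<^bsub>M\<^esub>) a ` carrier M"
proof
  have sub: "subgroup ((\<odot>\<^bsub>M\<^esub>) a ` carrier M) (add_monoid M)"
  proof (rule group.subgroupI[OF M.a_group])
    fix x y assume "x \<in> (\<odot>\<^bsub>M\<^esub>) a ` carrier M" "y \<in> (\<odot>\<^bsub>M\<^esub>) a ` carrier M"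
    then obtain u v where "x = a \<odot>\<^bsub>M\<^esub> u" "y = a \<odot>\<^bsub>M\<^esub> v" "u \<in> carrier M" "v \<in> carrier M"
      by auto
    then show "x \<otimes>\<^bsub>add_monoid M\<^esub> y \<in> (\<odot>\<^bsub>M\<^esub>) a ` carrier M"
      using assms by (auto simp: smult_r_distr intro!: image_eqI[of _ _ "u \<oplus>\<^bsub>M\<^esub> v"])
  next
    fix x assume "x \<in> (\<odot>\<^bsub>M\<^esub>) a ` carrier M"
    then obtain u where "x = a \<odot>\<^bsub>M\<^esub> u" "u \<in> carrier M"
      by auto
    then show "inv\<^bsub>add_monoid M\<^esub> x \<in> (\<odot>\<^bsub>M\<^esub>) a ` carrier M"
      using assms smult_r_minus[of a u]
      by (auto simp: a_inv_def[symmetric] intro!: image_eqI[of _ _ "\<ominus>\<^bsub>M\<^esub> u"])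
  qed (use assms in auto)
  show "ideal_smult (PIdl a) M \<subseteq> (\<odot>\<^bsub>M\<^esub>) a ` carrier M"
    unfolding ideal_smult_def
  proof (rule group.generate_subgroup_incl[OF M.a_group _ sub], safe)
    fix b x assume "b \<in> PIdl a" "x \<in> carrier M"
    then obtain r where "b = r \<otimes> a" "r \<in> carrier R" "x \<in> carrier M"
      by (auto simp: cgenideal_def)
    then show "b \<odot>\<^bsub>M\<^esub> x \<in> (\<odot>\<^bsub>M\<^esub>) a ` carrier M"
      using assms by (auto simp: R.m_comm[of r] smult_assoc1 intro!: image_eqI[of _ _ "r \<odot>\<^bsub>M\<^esub> x"])
  qed
  show "(\<odot>\<^bsub>M\<^esub>) a ` carrier M \<subseteq> ideal_smult (PIdl a) M"
    using R.cgenideal_self[OF assms] by (auto simp: ideal_smult_def intro: generate.incl)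
qed

lemma (in module) ideal_smult_mono:
  "I \<subseteq> J \<Longrightarrow> ideal_smult I M \<subseteq> ideal_smult J M"
  unfolding ideal_smult_def by (rule group.mono_generate[OF M.a_group]) auto

text \<open>In an algebra \<open>a x = x (a 1)\<close>, so the extended ideal is principal,
  generated by the image of \<open>a\<close>.\<close>

lemma (in algebra) ideal_cgenideal_smult:
  assumes "a \<in> carrier R"
  shows "ideal (ideal_smult (PIdl a) M) M"
proof -
  have "ideal_smult (PIdl a) M = PIdl\<^bsub>M\<^esub> (a \<odot>\<^bsub>M\<^esub> \<one>\<^bsub>M\<^esub>)"
    unfolding cgenideal_smult[OF assms] cgenideal_image
    using assms smult_assoc2[of a "\<one>\<^bsub>M\<^esub>"]
    by (intro image_cong refl) (simp add: m_comm[of _ "a \<odot>\<^bsub>M\<^esub> \<one>\<^bsub>M\<^esub>"])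
  then show ?thesis
    using assms by (simp add: cgenideal_ideal)
qed

lemma (in ring) ideal_content:
  assumes "module R M" "f \<in> carrier M"
  shows "ideal (content R M f) R"
proof -
  interpret module R M by fact
  \<comment> \<open>The unit ideal shows that the intersected family is nonempty; an empty
    intersection would be the whole type.\<close>
  have "f \<in> ideal_smult (carrier R) M"
    unfolding ideal_smult_def using assms(2) by (intro generate.incl) force
  then show ?thesis
    unfolding content_def using oneideal by (intro i_Intersect) auto
qed

lemma content_subset: "ideal I R \<Longrightarrow> f \<in> ideal_smult I M \<Longrightarrow> content R M f \<subseteq> I"
  by (auto simp: content_def)

section \<open>Discrete valuation rings and their algebras\<close>

locale dvr = principal_domain R for R (structure) +
  fixes \<mm> t
  assumes maximal_ideal: "maximalideal \<mm> R"
    and unique_maximal: "maximalideal \<nn> R \<Longrightarrow> \<nn> = \<mm>"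
    and t_carrier [simp]: "t \<in> carrier R"
    and \<mm>_eq: "\<mm> = PIdl t"
    and t_nonzero: "t \<noteq> \<zero>"
begin

text \<open>A nonzero nonunit has an irreducible divisor, which generates a maximal ideal in a
  principal ideal domain; there is only one such ideal.\<close>

lemma nonunit_mem: "a \<in> carrier R \<Longrightarrow> a \<notin> Units R \<Longrightarrow> a \<in> \<mm>"
proof (cases "a = \<zero>")
  case True
  then show ?thesis
    using cgenideal_ideal[of t] by (simp add: \<mm>_eq additive_subgroup.zero_closed ideal.axioms(1))
next
  case False
  assume a: "a \<in> carrier R" "a \<notin> Units R"
  have "a \<in> carrier R - {\<zero>}"
    using a(1) False by simp
  from exists_irreducible_divisor[OF this a(2)]
  obtain b where b: "b \<in> carrier R" "ring_irreducible b" "b divides a"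
    by blast
  from b(3) obtain c where "c \<in> carrier R" "a = b \<otimes> c"
    by (rule dividesE)
  with b(1) have "a \<in> PIdl b"
    unfolding cgenideal_def using m_comm by blast
  also have "PIdl b = \<mm>"
    by (rule unique_maximal[OF irreducible_imp_maximalideal[OF b(1,2)]])
  finally show ?thesis .
qed

lemma one_notin: "\<one> \<notin> \<mm>"
  using ideal.one_imp_carrier[OF maximalideal.axioms(1)[OF maximal_ideal]]
    maximalideal.I_notcarr[OF maximal_ideal] by auto

lemma mult_t_ne_one: "x \<in> carrier R \<Longrightarrow> t \<otimes> x \<noteq> \<one>"
  using one_notin by (auto simp: \<mm>_eq cgenideal_def m_comm[of t])

text \<open>The intersection of the powers is principal, say generated by \<open>a = b t\<close>.
  Cancelling \<open>t\<close> puts \<open>b\<close> back into the intersection, so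
  \<open>b = c a\<close> and \<open>a = t c a\<close>; a nonzero \<open>a\<close> would make
  \<open>t\<close> a unit.\<close>

lemma Inter_pow:
  assumes "x \<in> carrier R" "\<And>n::nat. x \<in> PIdl (t [^] n)"
  shows "x = \<zero>"
proof -
  let ?J = "\<Inter>n::nat. PIdl (t [^] n)"
  have "ideal ?J R"
    by (intro i_Intersect) (auto simp: cgenideal_ideal)
  then obtain a where a: "a \<in> carrier R" "?J = PIdl a"
    using exists_gen by blast
  then have aJ: "a \<in> PIdl (t [^] n)" for n :: nat
    using cgenideal_self by blast
  then obtain b where b: "b \<in> carrier R" "a = b \<otimes> t"
    using aJ[of 1] by (auto simp: cgenideal_def)
  have "b \<in> PIdl (t [^] n)" for n :: nat
  proof -
    \<comment> \<open>Cancelling \<open>t\<close> costs one power, hence the exponent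
      \<open>Suc n\<close>.\<close>
    obtain c where c: "c \<in> carrier R" "a = c \<otimes> (t [^] n \<otimes> t)"
      using aJ[of "Suc n"] by (auto simp: cgenideal_def)
    then have "b \<otimes> t = (c \<otimes> t [^] n) \<otimes> t"
      using b by (simp add: m_assoc)
    then have "b = c \<otimes> t [^] n"
      using b c t_nonzero by (metis m_rcancel m_closed nat_pow_closed t_carrier)
    then show ?thesis
      using c by (auto simp: cgenideal_def)
  qed
  then have "b \<in> PIdl a"
    using a by blast
  then obtain c where c: "c \<in> carrier R" "b = c \<otimes> a"
    by (auto simp: cgenideal_def)
  have "a = \<zero>"
  proof (rule ccontr)
    assume "a \<noteq> \<zero>"
    have "(t \<otimes> c) \<otimes> a = \<one> \<otimes> a"
      using a b c by (metis m_assoc m_comm l_one t_carrier m_closed)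
    then have "t \<otimes> c = \<one>"
      using a c \<open>a \<noteq> \<zero>\<close> by (metis m_rcancel m_closed one_closed t_carrier)
    with c show False
      using mult_t_ne_one by blast
  qed
  moreover have "x \<in> PIdl a"
    using assms a by blast
  ultimately show ?thesis
    by (auto simp: cgenideal_def)
qed

text \<open>By \<open>Inter_pow\<close> a nonzero generator \<open>a\<close> fails to be divisible
  by some power of \<open>t\<close>. One less than the least such exponent is the valuation
  \<open>n\<close> of \<open>a\<close>, and the cofactor of \<open>t [^] n\<close> is a unit, for
  otherwise \<open>t\<close> would divide it.\<close>

lemma ideal_cases:
  assumes "ideal I R"
  obtains "I = {\<zero>}" | n :: nat where "I = PIdl (t [^] n)"
proof -
  obtain a where a: "a \<in> carrier R" "I = PIdl a"
    using exists_gen assms by blast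
  show thesis
  proof (cases "a = \<zero>")
    case True
    then show thesis
      using a that(1) by (simp add: cgenideal_zero)
  next
    case False
    let ?Q = "\<lambda>n::nat. a \<notin> PIdl (t [^] n)"
    obtain m where m: "?Q m" "\<And>k. k < m \<Longrightarrow> \<not> ?Q k"
      using False Inter_pow[of a] a exists_least_iff[of ?Q] by blast
    have "a \<in> PIdl (t [^] (0::nat))"
      using a by (auto simp: cgenideal_def intro: exI[of _ a])
    with m(1) obtain n where n: "m = Suc n"
      by (cases m) auto
    then obtain b where b: "b \<in> carrier R" "a = b \<otimes> t [^] n"
      using m(2)[of n] by (auto simp: cgenideal_def)
    have "b \<in> Units R"
    proof (rule ccontr)
      assume "b \<notin> Units R"
      then obtain c where "c \<in> carrier R" "b = c \<otimes> t"
        using nonunit_mem[of b] b by (auto simp: \<mm>_eq cgenideal_def)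
      then have "a = c \<otimes> t [^] m"
        using b n by (simp add: m_assoc m_comm[of t])
      with m(1) \<open>c \<in> carrier R\<close> show False
        by (auto simp: cgenideal_def)
    qed
    then have "PIdl a = PIdl (t [^] n)"
      using b a by (metis associated_iff_same_ideal associatedI2' nat_pow_closed t_carrier m_comm
          Units_closed)
    with a that(2) show thesis by simp
  qed
qed

end

text \<open>The two assumptions are the consequences of faithful flatness that control contents:
  \<open>t\<close> is a nonzerodivisor on \<open>S\<close>, and the extension of
  \<open>\<mm>\<close> is proper.\<close>

locale dvr_algebra = dvr R \<mm> t + S: algebra R S
  for R (structure) and \<mm> t and S +
  assumes t_cancel: "x \<in> carrier S \<Longrightarrow> t \<odot>\<^bsub>S\<^esub> x = \<zero>\<^bsub>S\<^esub> \<Longrightarrow> x = \<zero>\<^bsub>S\<^esub>"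
    and t_not_surj: "(\<odot>\<^bsub>S\<^esub>) t ` carrier S \<noteq> carrier S"
begin

abbreviation tS where "tS \<equiv> (\<odot>\<^bsub>S\<^esub>) t ` carrier S"

lemma pow_t_cancel_zero:
  "x \<in> carrier S \<Longrightarrow> t [^] (n::nat) \<odot>\<^bsub>S\<^esub> x = \<zero>\<^bsub>S\<^esub> \<Longrightarrow> x = \<zero>\<^bsub>S\<^esub>"
proof (induction n arbitrary: x)
  case 0
  from 0(2) show ?case
    unfolding nat_pow_0 S.smult_one[OF 0(1)] .
next
  case (Suc n)
  have tx: "t \<odot>\<^bsub>S\<^esub> x \<in> carrier S"
    by (rule S.smult_closed[OF t_carrier Suc.prems(1)])
  have "t [^] n \<odot>\<^bsub>S\<^esub> (t \<odot>\<^bsub>S\<^esub> x) = t [^] Suc n \<odot>\<^bsub>S\<^esub> x"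
    unfolding nat_pow_Suc
    by (rule S.smult_assoc1[symmetric, OF nat_pow_closed[OF t_carrier] t_carrier Suc.prems(1)])
  from Suc.IH[OF tx this[unfolded Suc.prems(2)]] show ?case
    by (rule t_cancel[OF Suc.prems(1)])
qed

lemma pow_t_cancel:
  assumes "x \<in> carrier S" "y \<in> carrier S" "t [^] (n::nat) \<odot>\<^bsub>S\<^esub> x = t [^] n \<odot>\<^bsub>S\<^esub> y"
  shows "x = y"
proof -
  have "t [^] n \<odot>\<^bsub>S\<^esub> (x \<ominus>\<^bsub>S\<^esub> y) = \<zero>\<^bsub>S\<^esub>"
    using assms by (simp add: a_minus_def S.smult_r_distr S.smult_r_minus S.r_neg)
  then have "x \<ominus>\<^bsub>S\<^esub> y = \<zero>\<^bsub>S\<^esub>"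
    by (rule pow_t_cancel_zero[OF S.minus_closed[OF assms(1,2)]])
  then show ?thesis
    unfolding S.r_right_minus_eq[OF assms(1,2)] .
qed

section \<open>Contents of elements of \<open>S\<close>\<close>

lemma zero_smult: "ideal_smult {\<zero>} S = {\<zero>\<^bsub>S\<^esub>}"
  using S.cgenideal_smult[of \<zero>] by (auto simp: cgenideal_zero)

lemma content_zero: "content R S \<zero>\<^bsub>S\<^esub> = {\<zero>}"
proof
  show "content R S \<zero>\<^bsub>S\<^esub> \<subseteq> {\<zero>}"
    by (rule content_subset) (simp_all add: zero_smult zeroideal)
  show "{\<zero>} \<subseteq> content R S \<zero>\<^bsub>S\<^esub>"
    by (auto simp: content_def intro: additive_subgroup.zero_closed ideal.axioms(1))
qed

lemma zero_mem_tS: "\<zero>\<^bsub>S\<^esub> \<in> tS"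
  by (rule image_eqI[of _ _ "\<zero>\<^bsub>S\<^esub>"]) simp_all

text \<open>The ideals competing in the content are zero or generated by some
  \<open>t [^] k\<close>. The zero ideal would force \<open>h\<close> to vanish, and
  \<open>k > n\<close> would make \<open>h\<close> divisible by \<open>t\<close>; so
  \<open>k \<le> n\<close>, and every competitor contains \<open>t [^] n\<close>.\<close>

lemma content_pow_t:
  assumes h: "h \<in> carrier S" "h \<notin> tS"
  shows "content R S (t [^] (n::nat) \<odot>\<^bsub>S\<^esub> h) = PIdl (t [^] n)"
proof
  show "content R S (t [^] n \<odot>\<^bsub>S\<^esub> h) \<subseteq> PIdl (t [^] n)"
    using h by (intro content_subset) (simp_all add: cgenideal_ideal S.cgenideal_smult)
  have "t [^] n \<in> I" if I: "ideal I R" "t [^] n \<odot>\<^bsub>S\<^esub> h \<in> ideal_smult I S" for I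
    using I(1)
  proof (cases rule: ideal_cases)
    case 1
    then have "h = \<zero>\<^bsub>S\<^esub>"
      using I(2) h pow_t_cancel_zero[of h n] by (simp add: zero_smult)
    with h(2) zero_mem_tS show ?thesis
      by simp
  next
    case (2 k)
    then obtain x where x: "x \<in> carrier S" "t [^] n \<odot>\<^bsub>S\<^esub> h = t [^] k \<odot>\<^bsub>S\<^esub> x"
      using I(2) by (auto simp: S.cgenideal_smult)
    have "k \<le> n"
    proof (rule ccontr)
      assume "\<not> k \<le> n"
      \<comment> \<open>The form \<open>n + Suc j\<close> leaves an explicit factor \<open>t\<close>
        after \<open>t [^] n\<close> is cancelled.\<close>
      then obtain j where k: "k = n + Suc j"
        by (metis less_imp_Suc_add not_le add_Suc_right)
      have pow_k: "t [^] k = t [^] n \<otimes> (t \<otimes> t [^] j)"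
        by (simp add: k nat_pow_mult[symmetric] m_assoc m_comm[of t "t [^] j"])
      have "t [^] n \<odot>\<^bsub>S\<^esub> h = t [^] n \<odot>\<^bsub>S\<^esub> (t \<odot>\<^bsub>S\<^esub> (t [^] j \<odot>\<^bsub>S\<^esub> x))"
        unfolding x(2) using x(1) by (simp add: pow_k S.smult_assoc1)
      then have "h = t \<odot>\<^bsub>S\<^esub> (t [^] j \<odot>\<^bsub>S\<^esub> x)"
        using x h by (intro pow_t_cancel[of h _ n]) auto
      with h(2) x show False
        by auto
    qed
    then have "t [^] n = t [^] (n - k) \<otimes> t [^] k"
      by (simp add: nat_pow_mult)
    then show ?thesis
      using 2 by (auto simp: cgenideal_def)
  qed
  moreover have "ideal (content R S (t [^] n \<odot>\<^bsub>S\<^esub> h)) R"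
    using h by (intro ideal_content S.module) simp
  ultimately show "PIdl (t [^] n) \<subseteq> content R S (t [^] n \<odot>\<^bsub>S\<^esub> h)"
    by (intro cgenideal_minimal) (auto simp: content_def)
qed

lemma content_notin_tS: "h \<in> carrier S \<Longrightarrow> h \<notin> tS \<Longrightarrow> content R S h = carrier R"
  using content_pow_t[of h 0] by (simp add: cgenideal_one)

text \<open>The hypothesis on the intersection bounds the powers of \<open>t\<close> dividing
  \<open>f\<close>. Extracting the largest one leaves a cofactor outside \<open>tS\<close>.\<close>

lemma decomposition:
  assumes f: "f \<in> carrier S" "f \<noteq> \<zero>\<^bsub>S\<^esub>"
    and inter: "(\<Inter>n::nat. (\<odot>\<^bsub>S\<^esub>) (t [^] n) ` carrier S) = {\<zero>\<^bsub>S\<^esub>}"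
  obtains n :: nat and h where "h \<in> carrier S" "h \<notin> tS" "f = t [^] n \<odot>\<^bsub>S\<^esub> h"
proof -
  let ?Q = "\<lambda>n::nat. f \<notin> (\<odot>\<^bsub>S\<^esub>) (t [^] n) ` carrier S"
  have "\<exists>n. ?Q n"
    using f inter by blast
  then obtain m where m: "?Q m" "\<And>k. k < m \<Longrightarrow> \<not> ?Q k"
    using exists_least_iff[of ?Q] by blast
  have "f \<in> (\<odot>\<^bsub>S\<^esub>) (t [^] (0::nat)) ` carrier S"
    using f by (auto intro: image_eqI[of _ _ f])
  with m(1) obtain n where n: "m = Suc n"
    by (cases m) auto
  then obtain h where h: "h \<in> carrier S" "f = t [^] n \<odot>\<^bsub>S\<^esub> h"
    using m(2)[of n] by auto
  have "h \<notin> tS"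
  proof
    assume "h \<in> tS"
    then obtain x where "x \<in> carrier S" "f = t [^] m \<odot>\<^bsub>S\<^esub> x"
      using h n by (auto simp: S.smult_assoc1)
    with m(1) show False
      by auto
  qed
  with h that show thesis
    by blast
qed

text \<open>Primeness keeps the product of two cofactors outside \<open>tS\<close>, so
  \<open>content_pow_t\<close> gives the contents of \<open>f\<close>, \<open>g\<close> and their
  product. Zero has no such factorization and is treated apart.\<close>

lemma gaussian_of_prime:
  assumes flat: "faithfully_flat R S"
    and prime: "primeideal tS S"
    and inter: "(\<Inter>n::nat. (\<odot>\<^bsub>S\<^esub>) (t [^] n) ` carrier S) = {\<zero>\<^bsub>S\<^esub>}"
  shows "gaussian_algebra R S"
proof -
  have "f \<in> ideal_smult (content R S f) S" if f: "f \<in> carrier S" for f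
  proof (cases "f = \<zero>\<^bsub>S\<^esub>")
    case True
    then show ?thesis
      by (simp add: content_zero zero_smult)
  next
    case False
    from decomposition[OF f False inter] obtain n h
      where "h \<in> carrier S" "h \<notin> tS" "f = t [^] (n::nat) \<odot>\<^bsub>S\<^esub> h" .
    then show ?thesis
      by (simp add: content_pow_t S.cgenideal_smult)
  qed
  moreover have "content R S (f \<otimes>\<^bsub>S\<^esub> g) = content R S f \<cdot> content R S g"
    if fg: "f \<in> carrier S" "g \<in> carrier S" for f g
  proof -
    consider "f = \<zero>\<^bsub>S\<^esub>" | "g = \<zero>\<^bsub>S\<^esub>" | "f \<noteq> \<zero>\<^bsub>S\<^esub>" "g \<noteq> \<zero>\<^bsub>S\<^esub>"
      by blast
    then show ?thesis
    proof cases
      case 1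
      have "ideal (content R S g) R"
        using fg by (intro ideal_content S.module)
      with 1 fg show ?thesis
        by (simp add: content_zero ideal_prod_commute[OF zeroideal] ideal_prod_zero)
    next
      case 2
      have "ideal (content R S f) R"
        using fg by (intro ideal_content S.module)
      with 2 fg show ?thesis
        by (simp add: content_zero ideal_prod_zero)
    next
      case 3
      from decomposition[OF fg(1) 3(1) inter] obtain n h
        where h: "h \<in> carrier S" "h \<notin> tS" "f = t [^] (n::nat) \<odot>\<^bsub>S\<^esub> h" .
      from decomposition[OF fg(2) 3(2) inter] obtain k l
        where l: "l \<in> carrier S" "l \<notin> tS" "g = t [^] (k::nat) \<odot>\<^bsub>S\<^esub> l" .
      have "h \<otimes>\<^bsub>S\<^esub> l \<notin> tS"
        using primeideal.I_prime[OF prime h(1) l(1)] h(2) l(2) by blast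
      moreover have "f \<otimes>\<^bsub>S\<^esub> g = t [^] (n + k) \<odot>\<^bsub>S\<^esub> (h \<otimes>\<^bsub>S\<^esub> l)"
      proof -
        \<comment> \<open>The rule \<open>smult_assoc2\<close> extracts scalars from the left factor
          only, so the factors are swapped before the second extraction.\<close>
        have "f \<otimes>\<^bsub>S\<^esub> g = t [^] n \<odot>\<^bsub>S\<^esub> ((t [^] k \<odot>\<^bsub>S\<^esub> l) \<otimes>\<^bsub>S\<^esub> h)"
          using h l by (simp add: S.smult_assoc2 S.m_comm[of h])
        also have "\<dots> = t [^] (n + k) \<odot>\<^bsub>S\<^esub> (h \<otimes>\<^bsub>S\<^esub> l)"
          using h l by (simp add: S.smult_assoc2 S.m_comm[of l] S.smult_assoc1
              nat_pow_mult[symmetric])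
        finally show ?thesis .
      qed
      ultimately show ?thesis
        using h l by (simp add: content_pow_t ideal_prod_cgenideal nat_pow_mult)
    qed
  qed
  ultimately show ?thesis
    unfolding gaussian_algebra_def ohm_rush_algebra_def
    using flat S.algebra_axioms by blast
qed

text \<open>The exponent \<open>n = 1\<close> works, since the zeroth power of the content is the
  unit ideal.\<close>

lemma content_algebra_of_gaussian:
  assumes "gaussian_algebra R S"
  shows "content_algebra R S"
proof -
  interpret I: comm_monoid "ideals_set R"
    by (rule ideals_set_is_comm_monoid)
  have "ideal_pow R (content R S f) 1 \<cdot> content R S g =
      ideal_pow R (content R S f) (1 - 1) \<cdot> content R S (f \<otimes>\<^bsub>S\<^esub> g)"
    if fg: "f \<in> carrier S" "g \<in> carrier S" for f g
  proof -
    have ideals: "ideal (content R S f) R" "ideal (content R S (f \<otimes>\<^bsub>S\<^esub> g)) R"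
      using fg by (auto intro!: ideal_content S.module)
    then have "ideal_pow R (content R S f) 1 = content R S f"
      using I.nat_pow_eone[of "content R S f"] by (simp add: ideals_set_def)
    moreover have "ideal_pow R (content R S f) (1 - 1) = carrier R"
      by (simp add: ideals_set_def)
    ultimately show ?thesis
      using assms fg ideals
      by (simp add: gaussian_algebra_def ideal_prod_commute[OF oneideal] ideal_prod_one)
  qed
  then show ?thesis
    using assms unfolding gaussian_algebra_def content_algebra_def
    by (meson zero_less_one)
qed

text \<open>For \<open>f\<close> and \<open>g\<close> outside \<open>tS\<close> both contents are
  the unit ideal, and the content formula passes this to the product. A product in \<open>tS\<close>
  would have content inside \<open>\<mm>\<close>.\<close>

lemma prime_of_content_algebra:
  assumes "content_algebra R S"
  shows "primeideal tS S"
proof (rule primeidealI)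
  interpret I: comm_monoid "ideals_set R"
    by (rule ideals_set_is_comm_monoid)
  show "ideal tS S"
    using S.ideal_cgenideal_smult[of t] by (simp add: S.cgenideal_smult)
  show "cring S"
    by (rule S.M_cring)
  show "carrier S \<noteq> tS"
    using t_not_surj by simp
  fix f g assume fg: "f \<in> carrier S" "g \<in> carrier S" "f \<otimes>\<^bsub>S\<^esub> g \<in> tS"
  show "f \<in> tS \<or> g \<in> tS"
  proof (rule ccontr)
    assume "\<not> (f \<in> tS \<or> g \<in> tS)"
    then have fg_content: "content R S f = carrier R" "content R S g = carrier R"
      using fg by (simp_all add: content_notin_tS)
    \<comment> \<open>The exponent in the content formula is unknown, so all powers of the unit
      ideal are needed.\<close>
    have pow: "ideal_pow R (carrier R) n = carrier R" for n :: nat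
      using I.nat_pow_one[of n] by (simp add: ideals_set_def)
    have "ideal (content R S (f \<otimes>\<^bsub>S\<^esub> g)) R"
      using fg by (intro ideal_content S.module) simp
    moreover have "carrier R \<cdot> carrier R = carrier R \<cdot> content R S (f \<otimes>\<^bsub>S\<^esub> g)"
      using assms fg(1,2) unfolding content_algebra_def by (metis fg_content pow)
    ultimately have "content R S (f \<otimes>\<^bsub>S\<^esub> g) = carrier R"
      by (simp add: ideal_prod_commute[OF oneideal] ideal_prod_one oneideal)
    moreover have "content R S (f \<otimes>\<^bsub>S\<^esub> g) \<subseteq> \<mm>"
      unfolding \<mm>_eq using fg
      by (intro content_subset) (simp_all add: S.cgenideal_smult cgenideal_ideal)
    ultimately show False
      using one_notin by auto
  qed
qed

text \<open>The Ohm-Rush condition decides: the content of such an \<open>f\<close> lies in every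
  power of \<open>\<mm>\<close>, hence is zero by \<open>Inter_pow\<close>, and \<open>f\<close>
  lies in its extension.\<close>

lemma inter_of_content_algebra:
  assumes "content_algebra R S"
  shows "(\<Inter>n::nat. (\<odot>\<^bsub>S\<^esub>) (t [^] n) ` carrier S) = {\<zero>\<^bsub>S\<^esub>}"
proof
  show "(\<Inter>n::nat. (\<odot>\<^bsub>S\<^esub>) (t [^] n) ` carrier S) \<subseteq> {\<zero>\<^bsub>S\<^esub>}"
  proof
    fix f assume f: "f \<in> (\<Inter>n::nat. (\<odot>\<^bsub>S\<^esub>) (t [^] n) ` carrier S)"
    then have fS: "f \<in> carrier S"
      by auto
    have "content R S f \<subseteq> PIdl (t [^] n)" for n :: nat
      using f by (intro content_subset) (auto simp: S.cgenideal_smult cgenideal_ideal)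
    moreover have "content R S f \<subseteq> carrier R"
      using ideal_content[OF S.module fS] by (auto dest: ideal.Icarr)
    ultimately have "content R S f \<subseteq> {\<zero>}"
      using Inter_pow by blast
    then have "ideal_smult (content R S f) S \<subseteq> {\<zero>\<^bsub>S\<^esub>}"
      using S.ideal_smult_mono[of "content R S f" "{\<zero>}"] by (simp add: zero_smult)
    moreover have "f \<in> ideal_smult (content R S f) S"
      using assms fS by (simp add: content_algebra_def ohm_rush_algebra_def)
    ultimately show "f \<in> {\<zero>\<^bsub>S\<^esub>}"
      by blast
  qed
  show "{\<zero>\<^bsub>S\<^esub>} \<subseteq> (\<Inter>n::nat. (\<odot>\<^bsub>S\<^esub>) (t [^] n) ` carrier S)"
    by (auto intro!: image_eqI[of _ _ "\<zero>\<^bsub>S\<^esub>"])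
qed

end

theorem proposition3p1:
  fixes R :: "('a, 'c) ring_scheme" and \<mm> :: "'a set"
    and S :: "('a, 'b, 'd) module_scheme"
  assumes "discrete_valuation_ring R \<mm>"
    and "algebra R S"
    and "faithfully_flat R S"
  shows "(content_algebra R S \<longleftrightarrow>
            primeideal (ideal_smult \<mm> S) S \<and>
            (\<Inter>n. ideal_smult (ideal_pow R \<mm> n) S) = {\<zero>\<^bsub>S\<^esub>}) \<and>
         (content_algebra R S \<longleftrightarrow> gaussian_algebra R S)"
proof -
  from assms(1) have pd: "principal_domain R" and max: "maximalideal \<mm> R"
    and uniq: "\<And>\<nn>. maximalideal \<nn> R \<Longrightarrow> \<nn> = \<mm>" and nonzero: "\<mm> \<noteq> {\<zero>\<^bsub>R\<^esub>}"
    by (auto simp: discrete_valuation_ring_def)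
  interpret principal_domain R
    by (rule pd)
  obtain t where t: "t \<in> carrier R" "\<mm> = PIdl\<^bsub>R\<^esub> t"
    using exists_gen[OF maximalideal.axioms(1)[OF max]] by blast
  interpret dvr R \<mm> t
  proof (intro dvr.intro dvr_axioms.intro)
    show "t \<noteq> \<zero>\<^bsub>R\<^esub>"
      using nonzero t by (auto simp: cgenideal_zero)
  qed (fact pd max uniq t)+
  interpret A: algebra R S
    by (rule assms(2))
  interpret dvr_algebra R \<mm> t S
  proof (intro dvr_algebra.intro dvr_algebra_axioms.intro assms(2))
    show "dvr R \<mm> t" ..
  next
    fix x assume x: "x \<in> carrier S" "t \<odot>\<^bsub>S\<^esub> x = \<zero>\<^bsub>S\<^esub>"
    \<comment> \<open>As \<open>R\<close> is a domain, multiplication by zero followed by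
      \<open>t\<close> is exact on \<open>R\<close>, hence on \<open>S\<close>.\<close>
    have "(\<otimes>\<^bsub>R\<^esub>) \<zero>\<^bsub>R\<^esub> ` carrier R = {x \<in> carrier R. t \<otimes>\<^bsub>R\<^esub> x = \<zero>\<^bsub>R\<^esub>}"
      using t_nonzero by (auto simp: integral_iff intro!: image_eqI[of _ _ "\<zero>\<^bsub>R\<^esub>"])
    then have "{s \<in> carrier S. t \<odot>\<^bsub>S\<^esub> s = \<zero>\<^bsub>S\<^esub>} = (\<odot>\<^bsub>S\<^esub>) \<zero>\<^bsub>R\<^esub> ` carrier S"
      using faithfully_flat_exact_iff[OF assms(3), of "\<zero>\<^bsub>R\<^esub>" t] by simp
    with x have "x \<in> (\<odot>\<^bsub>S\<^esub>) \<zero>\<^bsub>R\<^esub> ` carrier S"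
      by blast
    then show "x = \<zero>\<^bsub>S\<^esub>"
      by auto
  next
    \<comment> \<open>Multiplication by \<open>t\<close> followed by zero is not exact on
      \<open>R\<close>; the converse half of faithful flatness transfers this failure to
      \<open>S\<close>.\<close>
    have "\<one>\<^bsub>R\<^esub> \<notin> (\<otimes>\<^bsub>R\<^esub>) t ` carrier R"
      using mult_t_ne_one by (metis imageE)
    then have "(\<otimes>\<^bsub>R\<^esub>) t ` carrier R \<noteq> {x \<in> carrier R. \<zero>\<^bsub>R\<^esub> \<otimes>\<^bsub>R\<^esub> x = \<zero>\<^bsub>R\<^esub>}"
      by auto
    then have "(\<odot>\<^bsub>S\<^esub>) t ` carrier S \<noteq> {s \<in> carrier S. \<zero>\<^bsub>R\<^esub> \<odot>\<^bsub>S\<^esub> s = \<zero>\<^bsub>S\<^esub>}"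
      using faithfully_flat_exact_iff[OF assms(3), of t "\<zero>\<^bsub>R\<^esub>"] by simp
    also have "{s \<in> carrier S. \<zero>\<^bsub>R\<^esub> \<odot>\<^bsub>S\<^esub> s = \<zero>\<^bsub>S\<^esub>} = carrier S"
      by auto
    finally show "(\<odot>\<^bsub>S\<^esub>) t ` carrier S \<noteq> carrier S" .
  qed
  have extended: "ideal_smult \<mm> S = tS"
    using A.cgenideal_smult[OF t(1)] t(2) by simp
  have extended_pow:
    "ideal_smult (ideal_pow R \<mm> n) S = (\<odot>\<^bsub>S\<^esub>) (t [^]\<^bsub>R\<^esub> n) ` carrier S" for n
    using t by (simp add: ideal_pow_cgenideal A.cgenideal_smult)
  \<comment> \<open>The implications form a cycle from the ideal conditions through Gaussian and
    content algebras, which gives both equivalences.\<close>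
  show ?thesis
    unfolding extended extended_pow
    using gaussian_of_prime[OF assms(3)] content_algebra_of_gaussian prime_of_content_algebra
      inter_of_content_algebra
    by blast
qed

end
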